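(* Let $\mathcal{A}$ be a lock-free implementation of $k$-CAS (from atomic read, write and CAS), and let $\mathcal{C}=\{c_0,\dots,c_\ell\}$ be a star configuration of calls to $k$-CAS, such that all calls in $\mathcal{C}$ have the correct old values for their target addresses and each new value is distinct from its respective old value. Then there exists an execution $E$ of $\mathcal{A}$ (in which the calls of $\mathcal{C}$ are performed, $c_i$ by process $p_i$, with $p_0,\dots,p_\ell$ distinct) such that, for all $i\in\{1,\dots,\ell\}$, the ranges of $c_0$ and $c_i$ in $E$ are non-disjoint.
   Context: Model: standard asynchronous shared memory with deterministic processes and atomic read, write and CAS on base memory locations; $\mathrm{CAS}(a,e,v)$ atomically writes $v$ to $a$ if its content equals $e$ and returns an indication of success or failure. There are at least $\ell+1$ processes. $k$-CAS takes $k$ distinct addresses with an old (expected) value and a new value for each; atomically, if every address currently has its old value, all are set to their new values and the call returns success; otherwise nothing changes and it returns failure. Implementations are linearizable. Lock-free: as long as some process with an ongoing operation keeps taking steps, eventually some ongoing operation completes. "Correct old values" means that the old values agree with the values of the addresses in the initial state. The set of targets of a call $k$-CAS$(a_1,\dots,a_k,\dots)$ is $\{a_1,\dots,a_k\}$. The range of a call in an execution $E$ is the set of base locations on which single-word CAS is performed, successfully or not, during the call in $E$. A set $\{c_0,\dots,c_\ell\}$ of calls to $k$-CAS is in a star configuration if (1) the sets of targets of $c_0$ and $c_i$ are non-disjoint for all $i\in\{1,\dots,\ell\}$, and (2) the sets of targets of $c_i$ and $c_j$ are disjoint for all $i\neq j\in\{1,\dots,\ell\}$. *)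

theory Defs
  imports Main
begin

text \<open>Multi-word CAS as a sequential object. A call lists, for each address, the triple
  (address, old value, new value); the result is the new state and the success indication.\<close>

type_synonym ('a, 'v) kcas_call = "('a \<times> 'v \<times> 'v) list"

definition targets :: "('a, 'v) kcas_call \<Rightarrow> 'a set" where
  "targets c = fst ` set c"

definition valid_call :: "nat \<Rightarrow> ('a, 'v) kcas_call \<Rightarrow> bool" where
  "valid_call k c \<longleftrightarrow> length c = k \<and> distinct (map fst c)"

definition correct_old_values :: "('a \<Rightarrow> 'v) \<Rightarrow> ('a, 'v) kcas_call \<Rightarrow> bool" where
  "correct_old_values s c \<longleftrightarrow> (\<forall>(a, old, new) \<in> set c. s a = old)"

definition new_values_differ :: "('a, 'v) kcas_call \<Rightarrow> bool" where
  "new_values_differ c \<longleftrightarrow> (\<forall>(a, old, new) \<in> set c. new \<noteq> old)"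

definition kcas :: "('a, 'v) kcas_call \<Rightarrow> ('a \<Rightarrow> 'v) \<Rightarrow> ('a \<Rightarrow> 'v) \<times> bool" where
  "kcas c s =
    (if \<forall>(a, old, new) \<in> set c. s a = old
     then (fold (\<lambda>(a, old, new) s. s(a := new)) c s, True)
     else (s, False))"

definition star_configuration :: "nat \<Rightarrow> (nat \<Rightarrow> ('a, 'v) kcas_call) \<Rightarrow> bool" where
  "star_configuration l c \<longleftrightarrow>
    (\<forall>i\<in>{1..l}. targets (c 0) \<inter> targets (c i) \<noteq> {}) \<and>
    (\<forall>i\<in>{1..l}. \<forall>j\<in>{1..l}. i \<noteq> j \<longrightarrow> targets (c i) \<inter> targets (c j) = {})"


text \<open>Deterministic processes: the local state of a process with an ongoing operation
  determines its next action. The continuation stored in an action maps the answer of the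
  base memory to the next local state, so local computation is part of the steps. The state
  stored in \<open>Return\<close> is kept until the next invocation by the same process.\<close>

datatype ('l, 'w, 's) action =
    Read 'l "'w \<Rightarrow> 's"
  | Write 'l 'w 's
  | CAS 'l 'w 'w "bool \<Rightarrow> 's"
  | Return bool 's

text \<open>Type parameters: processes \<open>'p\<close>, local states \<open>'s\<close>, base locations \<open>'l\<close> with contents
  \<open>'w\<close>, addresses \<open>'a\<close> with values \<open>'v\<close>. Addresses need not be base locations.\<close>

record ('p, 's, 'l, 'w, 'a, 'v) implementation =
  init_mem :: "'l \<Rightarrow> 'w"
  init_local :: "'p \<Rightarrow> 's"
  begin_call :: "'p \<Rightarrow> 's \<Rightarrow> ('a, 'v) kcas_call \<Rightarrow> 's"
  program :: "'p \<Rightarrow> 's \<Rightarrow> ('l, 'w, 's) action"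

datatype 's status = Idle 's | Busy 's

type_synonym ('p, 's, 'l, 'w) config = "('l \<Rightarrow> 'w) \<times> ('p \<Rightarrow> 's status)"

datatype ('p, 'l, 'w, 'a, 'v) event =
    is_Invoke: Invoke (proc: 'p) (call_of: "('a, 'v) kcas_call")
  | ReadEv (proc: 'p) 'l 'w
  | WriteEv (proc: 'p) 'l 'w
  | CASEv (proc: 'p) 'l 'w 'w bool
  | is_Respond: Respond (proc: 'p) bool

inductive step ::
    "nat \<Rightarrow> ('p, 's, 'l, 'w, 'a, 'v) implementation \<Rightarrow>
     ('p, 's, 'l, 'w) config \<Rightarrow> ('p, 'l, 'w, 'a, 'v) event \<Rightarrow> ('p, 's, 'l, 'w) config \<Rightarrow> bool"
  for k :: nat and A :: "('p, 's, 'l, 'w, 'a, 'v) implementation"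
where
  step_invoke: "L p = Idle s \<Longrightarrow> valid_call k c \<Longrightarrow>
    step k A (M, L) (Invoke p c) (M, L(p := Busy (begin_call A p s c)))"
| step_read: "L p = Busy s \<Longrightarrow> program A p s = Read x f \<Longrightarrow>
    step k A (M, L) (ReadEv p x (M x)) (M, L(p := Busy (f (M x))))"
| step_write: "L p = Busy s \<Longrightarrow> program A p s = Write x w s' \<Longrightarrow>
    step k A (M, L) (WriteEv p x w) (M(x := w), L(p := Busy s'))"
| step_cas: "L p = Busy s \<Longrightarrow> program A p s = CAS x e w f \<Longrightarrow>
    step k A (M, L) (CASEv p x e w (M x = e))
      (if M x = e then M(x := w) else M, L(p := Busy (f (M x = e))))"
| step_return: "L p = Busy s \<Longrightarrow> program A p s = Return b s' \<Longrightarrow>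
    step k A (M, L) (Respond p b) (M, L(p := Idle s'))"

definition initial ::
    "('p, 's, 'l, 'w, 'a, 'v) implementation \<Rightarrow> ('p, 's, 'l, 'w) config" where
  "initial A = (init_mem A, \<lambda>p. Idle (init_local A p))"

inductive run ::
    "nat \<Rightarrow> ('p, 's, 'l, 'w, 'a, 'v) implementation \<Rightarrow>
     ('p, 's, 'l, 'w) config \<Rightarrow> ('p, 'l, 'w, 'a, 'v) event list \<Rightarrow>
     ('p, 's, 'l, 'w) config \<Rightarrow> bool"
  for k :: nat and A :: "('p, 's, 'l, 'w, 'a, 'v) implementation"
where
  run_Nil: "run k A C [] C"
| run_Cons: "step k A C e C' \<Longrightarrow> run k A C' es C'' \<Longrightarrow> run k A C (e # es) C''"

definition execution ::
    "nat \<Rightarrow> ('p, 's, 'l, 'w, 'a, 'v) implementation \<Rightarrow>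
     ('p, 'l, 'w, 'a, 'v) event list \<Rightarrow> bool" where
  "execution k A E \<longleftrightarrow> (\<exists>C. run k A (initial A) E C)"

definition infinite_execution ::
    "nat \<Rightarrow> ('p, 's, 'l, 'w, 'a, 'v) implementation \<Rightarrow>
     (nat \<Rightarrow> ('p, 's, 'l, 'w) config) \<Rightarrow> (nat \<Rightarrow> ('p, 'l, 'w, 'a, 'v) event) \<Rightarrow> bool" where
  "infinite_execution k A C ev \<longleftrightarrow>
    C 0 = initial A \<and> (\<forall>n. step k A (C n) (ev n) (C (Suc n)))"

definition ongoing :: "('p, 's, 'l, 'w) config \<Rightarrow> 'p \<Rightarrow> bool" where
  "ongoing C p \<longleftrightarrow> (\<exists>s. snd C p = Busy s)"

definition lock_free ::
    "nat \<Rightarrow> ('p, 's, 'l, 'w, 'a, 'v) implementation \<Rightarrow> bool" where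
  "lock_free k A \<longleftrightarrow>
    (\<forall>C ev. infinite_execution k A C ev \<longrightarrow>
      (\<forall>n p. ongoing (C n) p \<and> infinite {m. proc (ev m) = p} \<longrightarrow>
        (\<exists>m\<ge>n. is_Respond (ev m))))"


text \<open>A call in an execution is identified by the position of its invocation.\<close>

definition calls :: "('p, 'l, 'w, 'a, 'v) event list \<Rightarrow> nat set" where
  "calls E = {n. n < length E \<and> is_Invoke (E ! n)}"

text \<open>Position \<open>j\<close> is a step of call \<open>n\<close>, its response included.\<close>

definition in_call :: "('p, 'l, 'w, 'a, 'v) event list \<Rightarrow> nat \<Rightarrow> nat \<Rightarrow> bool" where
  "in_call E n j \<longleftrightarrow> n < j \<and> j < length E \<and> proc (E ! j) = proc (E ! n) \<and>
    (\<forall>m. n < m \<and> m < j \<longrightarrow> \<not> (is_Respond (E ! m) \<and> proc (E ! m) = proc (E ! n)))"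

definition responds_at ::
    "('p, 'l, 'w, 'a, 'v) event list \<Rightarrow> nat \<Rightarrow> nat \<Rightarrow> bool \<Rightarrow> bool" where
  "responds_at E n j b \<longleftrightarrow> in_call E n j \<and> E ! j = Respond (proc (E ! n)) b"

definition completed :: "('p, 'l, 'w, 'a, 'v) event list \<Rightarrow> nat \<Rightarrow> bool" where
  "completed E n \<longleftrightarrow> (\<exists>j b. responds_at E n j b)"

definition precedes :: "('p, 'l, 'w, 'a, 'v) event list \<Rightarrow> nat \<Rightarrow> nat \<Rightarrow> bool" where
  "precedes E m n \<longleftrightarrow> (\<exists>j b. responds_at E m j b \<and> j < n)"

definition call_range :: "('p, 'l, 'w, 'a, 'v) event list \<Rightarrow> nat \<Rightarrow> 'l set" where
  "call_range E n = {x. \<exists>j e w b. in_call E n j \<and> E ! j = CASEv (proc (E ! n)) x e w b}"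

text \<open>A linearization \<open>L\<close> of \<open>E\<close> orders all completed calls of \<open>E\<close> and some of the pending
  ones, respects the real-time order, and yields the responses that occur in \<open>E\<close> when the
  calls are applied one after the other to the initial state \<open>s\<close>.\<close>

definition linearization ::
    "('a \<Rightarrow> 'v) \<Rightarrow> ('p, 'l, 'w, 'a, 'v) event list \<Rightarrow> nat list \<Rightarrow> bool" where
  "linearization s E L \<longleftrightarrow>
    distinct L \<and> set L \<subseteq> calls E \<and> {n \<in> calls E. completed E n} \<subseteq> set L \<and>
    (\<forall>x<length L. \<forall>y<length L. precedes E (L ! x) (L ! y) \<longrightarrow> x < y) \<and>
    (\<forall>x<length L. \<forall>j b. responds_at E (L ! x) j b \<longrightarrow>
      snd (kcas (call_of (E ! (L ! x)))
        (fold (\<lambda>n t. fst (kcas (call_of (E ! n)) t)) (take x L) s)) = b)"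

definition linearizable ::
    "nat \<Rightarrow> ('a \<Rightarrow> 'v) \<Rightarrow> ('p, 's, 'l, 'w, 'a, 'v) implementation \<Rightarrow> bool" where
  "linearizable k s A \<longleftrightarrow> (\<forall>E. execution k A E \<longrightarrow> (\<exists>L. linearization s E L))"

definition lock_free_kcas_implementation ::
    "nat \<Rightarrow> ('a \<Rightarrow> 'v) \<Rightarrow> ('p, 's, 'l, 'w, 'a, 'v) implementation \<Rightarrow> bool" where
  "lock_free_kcas_implementation k s A \<longleftrightarrow> linearizable k s A \<and> lock_free k A"

end

theory Submission
  imports Defs
begin

text \<open>Valency argument. When all calls of the star have returned, either \<open>c\<^sub>0\<close> alone has
  succeeded or exactly the other calls have, so the response of any single call decides the
  outcome. Starting from the initial state both outcomes are possible: let \<open>c\<^sub>0\<close>, or else \<open>c\<^sub>1\<close>,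
  run alone first. By lock-freedom every schedule of the calls terminates, hence there is a
  critical state: both outcomes are still possible, but the next step of any process decides.
  No call has returned there. Two processes whose next steps decide differently must both be about
  to perform a CAS on the same location, since otherwise the steps commute or one of them is
  invisible to the other process, which could then run alone to its response. As both
  decisions occur, all processes are about to perform a CAS on one common location.\<close>

section \<open>Sequences of k-CAS operations in a star\<close>

text \<open>Old values are the initial ones, so whether a call of the star succeeds depends on the
  current state only through this set. The values themselves can be forgotten.\<close>

definition changed :: "('a \<Rightarrow> 'v) \<Rightarrow> ('a \<Rightarrow> 'v) \<Rightarrow> 'a set" where
  "changed s t = {a. t a \<noteq> s a}"

lemma fold_update_notin:
  assumes "a \<notin> fst ` set c"
  shows "fold (\<lambda>(a, old, new) t. t(a := new)) c t a = t a"
  using assms by (induction c arbitrary: t) auto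

lemma fold_update_in:
  assumes "distinct (map fst c)" "(a, old, new) \<in> set c"
  shows "fold (\<lambda>(a, old, new) t. t(a := new)) c t a = new"
  using assms by (induction c arbitrary: t) (auto simp: fold_update_notin)

lemma kcas_success_iff:
  assumes "correct_old_values s c"
  shows "snd (kcas c t) \<longleftrightarrow> targets c \<inter> changed s t = {}"
  using assms unfolding kcas_def correct_old_values_def targets_def changed_def by force

text \<open>A successful call writes values that differ from the initial ones, so all its targets
  join the set. No address ever leaves it, hence a call that is blocked once stays blocked.\<close>

lemma changed_kcas:
  assumes "correct_old_values s c" "new_values_differ c" "distinct (map fst c)"
  shows "changed s (fst (kcas c t)) =
    (if targets c \<inter> changed s t = {} then targets c \<union> changed s t else changed s t)"
proof (cases "targets c \<inter> changed s t = {}")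
  case True
  then have eq: "fst (kcas c t) = fold (\<lambda>(a, old, new) t. t(a := new)) c t"
    using kcas_success_iff[OF assms(1), of t] by (auto simp: kcas_def split: if_splits)
  have "fst (kcas c t) a \<noteq> s a \<longleftrightarrow> a \<in> targets c \<or> t a \<noteq> s a" for a
  proof (cases "a \<in> targets c")
    case True
    then obtain old new where "(a, old, new) \<in> set c"
      by (auto simp: targets_def)
    then show ?thesis
      using True assms fold_update_in[OF assms(3), of a old new t]
      by (auto simp: eq correct_old_values_def new_values_differ_def)
  next
    case False
    then show ?thesis
      by (simp add: eq targets_def fold_update_notin)
  qed
  with True show ?thesis
    by (auto simp: changed_def)
next
  case False
  then show ?thesis
    using kcas_success_iff[OF assms(1), of t] by (auto simp: kcas_def split: if_splits)
qed

definition seq_state :: "('q \<Rightarrow> ('a, 'v) kcas_call) \<Rightarrow> ('a \<Rightarrow> 'v) \<Rightarrow> 'q list \<Rightarrow> 'a \<Rightarrow> 'v" where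
  "seq_state cc s qs = fold (\<lambda>q t. fst (kcas (cc q) t)) qs s"

text \<open>The first call always succeeds. If it is the centre \<open>r\<close>, it blocks every
  leaf, since each leaf shares a target with it. If it is a leaf, it blocks \<open>r\<close>, while
  the leaves never hinder each other.\<close>

lemma changed_seq_state:
  assumes ok: "\<And>q. q \<in> P \<Longrightarrow> correct_old_values s (cc q) \<and> new_values_differ (cc q) \<and>
      distinct (map fst (cc q))"
    and star: "\<And>q. q \<in> P \<Longrightarrow> q \<noteq> r \<Longrightarrow> targets (cc r) \<inter> targets (cc q) \<noteq> {}"
      "\<And>q q'. q \<in> P \<Longrightarrow> q' \<in> P \<Longrightarrow> q \<noteq> r \<Longrightarrow> q' \<noteq> r \<Longrightarrow> q \<noteq> q' \<Longrightarrow>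
        targets (cc q) \<inter> targets (cc q') = {}"
    and "distinct qs" "set qs \<subseteq> P"
  shows "changed s (seq_state cc s qs) =
    (if qs \<noteq> [] \<and> hd qs = r then targets (cc r) else (\<Union>q\<in>set qs - {r}. targets (cc q)))"
  using assms(4,5)
proof (induction qs rule: rev_induct)
  case Nil
  then show ?case by (simp add: changed_def seq_state_def)
next
  case (snoc q qs)
  have q: "q \<in> P" "q \<notin> set qs" using snoc.prems by auto
  let ?D = "changed s (seq_state cc s qs)"
  have D: "?D = (if qs \<noteq> [] \<and> hd qs = r then targets (cc r)
      else (\<Union>q\<in>set qs - {r}. targets (cc q)))"
    using snoc by auto
  have D': "changed s (seq_state cc s (qs @ [q])) =
      (if targets (cc q) \<inter> ?D = {} then targets (cc q) \<union> ?D else ?D)"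
    using changed_kcas[of s "cc q"] ok[OF q(1)] by (simp add: seq_state_def)
  consider "qs = []" | "qs \<noteq> []" "hd qs = r" | "qs \<noteq> []" "hd qs \<noteq> r" "q = r"
    | "qs \<noteq> []" "hd qs \<noteq> r" "q \<noteq> r" by blast
  then show ?case
  proof cases
    case 1
    then show ?thesis using D D' by auto
  next
    case 2
    then have "q \<noteq> r" using q(2) hd_in_set by metis
    then have "targets (cc q) \<inter> ?D \<noteq> {}" using 2 star(1)[OF q(1)] D by auto
    then show ?thesis using 2 D D' by simp
  next
    case 3
    \<comment> \<open>The head of the list is an earlier leaf whose targets have all changed. It is
      the witness that the centre is blocked.\<close>
    then have h: "hd qs \<in> set qs - {r}" "hd qs \<in> P" using snoc.prems by auto
    have "?D = (\<Union>q\<in>set qs - {r}. targets (cc q))" using 3 D by simp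
    with h have "targets (cc q) \<inter> ?D \<noteq> {}" using 3(3) star(1)[OF h(2) 3(2)] by blast
    moreover have "set (qs @ [q]) - {r} = set qs - {r}" using 3 by auto
    ultimately show ?thesis using 3 D D' by simp
  next
    case 4
    have "targets (cc q) \<inter> targets (cc q') = {}" if "q' \<in> set qs - {r}" for q'
      using that 4 star(2)[of q q'] q snoc.prems by auto
    then have "targets (cc q) \<inter> ?D = {}" using 4 D by auto
    then show ?thesis using 4 D D' by auto
  qed
qed

text \<open>The call at the head of the order decides: with \<open>r\<close> at the head only
  \<open>r\<close> succeeds, and with a leaf at the head \<open>r\<close> fails and every leaf
  succeeds.\<close>

lemma star_outcome:
  assumes ok: "\<And>q. q \<in> P \<Longrightarrow> correct_old_values s (cc q) \<and> new_values_differ (cc q) \<and>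
      distinct (map fst (cc q))"
    and star: "\<And>q. q \<in> P \<Longrightarrow> q \<noteq> r \<Longrightarrow> targets (cc r) \<inter> targets (cc q) \<noteq> {}"
      "\<And>q q'. q \<in> P \<Longrightarrow> q' \<in> P \<Longrightarrow> q \<noteq> r \<Longrightarrow> q' \<noteq> r \<Longrightarrow> q \<noteq> q' \<Longrightarrow>
        targets (cc q) \<inter> targets (cc q') = {}"
    and qs: "distinct qs" "set qs = P" and "r \<in> P"
    and b: "\<And>x. x < length qs \<Longrightarrow>
      snd (kcas (cc (qs ! x)) (seq_state cc s (take x qs))) = b (qs ! x)"
    and q: "q \<in> P" "q \<noteq> r"
  shows "b q = (\<not> b r)"
proof -
  have succ: "b (qs ! x) \<longleftrightarrow> targets (cc (qs ! x)) \<inter>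
      (if x \<noteq> 0 \<and> hd qs = r then targets (cc r)
       else (\<Union>q\<in>set (take x qs) - {r}. targets (cc q))) = {}" if x: "x < length qs" for x
  proof -
    have "correct_old_values s (cc (qs ! x))" using ok x qs(2) nth_mem by blast
    moreover have "changed s (seq_state cc s (take x qs)) =
      (if take x qs \<noteq> [] \<and> hd (take x qs) = r then targets (cc r)
       else (\<Union>q\<in>set (take x qs) - {r}. targets (cc q)))"
    proof (rule changed_seq_state[of P])
      show "distinct (take x qs)" using qs(1) by simp
      show "set (take x qs) \<subseteq> P" unfolding qs(2)[symmetric] by (rule set_take_subset)
    qed (fact ok star)+
    moreover have "take x qs \<noteq> [] \<and> hd (take x qs) = r \<longleftrightarrow> x \<noteq> 0 \<and> hd qs = r"
      using x by auto
    ultimately show ?thesis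
      using kcas_success_iff[of s "cc (qs ! x)" "seq_state cc s (take x qs)"] b[OF x] by simp
  qed
  have "q \<in> set qs" "r \<in> set qs" using q(1) \<open>r \<in> P\<close> qs(2) by simp_all
  then obtain x y where x: "x < length qs" "qs ! x = q" and y: "y < length qs" "qs ! y = r"
    unfolding in_set_conv_nth by blast
  from x(1) have hd: "hd qs = qs ! 0" by (cases qs) simp_all
  show ?thesis
  proof (cases "y = 0")
    case True
    then have "x \<noteq> 0" using x(2) y(2) q(2) by metis
    have "hd qs = r" using True y(2) hd by simp
    have "targets (cc q) \<inter> targets (cc r) \<noteq> {}" using star(1)[OF q] by (simp add: Int_commute)
    with \<open>x \<noteq> 0\<close> \<open>hd qs = r\<close> have "\<not> b q" using succ[OF x(1)] unfolding x(2) by simp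
    moreover have "b r" using succ[OF y(1)] y(2) unfolding True by simp
    ultimately show ?thesis by simp
  next
    case False
    have "0 < length qs" using y(1) by linarith
    then have "qs ! 0 \<noteq> qs ! y" using False nth_eq_iff_index_eq[OF qs(1) _ y(1)] by metis
    then have ne: "hd qs \<noteq> r" unfolding hd y(2) .
    have "hd qs \<in> set (take y qs)"
      using False y(1) unfolding hd in_set_conv_nth by (intro exI[of _ 0]) auto
    then have h: "hd qs \<in> set (take y qs) - {r}" "hd qs \<in> P"
      using ne qs(2) by (auto dest: in_set_takeD)
    then have "targets (cc r) \<inter> (\<Union>q\<in>set (take y qs) - {r}. targets (cc q)) \<noteq> {}"
      using star(1)[OF h(2) ne] by blast
    then have "\<not> b r" using succ[OF y(1)] ne unfolding y(2) by simp
    have "q \<notin> set (take x qs)"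
    proof
      assume "q \<in> set (take x qs)"
      then obtain z where "z < x" "qs ! z = qs ! x" using x by (auto simp: in_set_conv_nth)
      then show False using x(1) qs(1) by (simp add: nth_eq_iff_index_eq)
    qed
    have "targets (cc q) \<inter> targets (cc q') = {}" if q': "q' \<in> set (take x qs) - {r}" for q'
    proof (rule star(2))
      show "q' \<in> P" using q' qs(2) by (auto dest: in_set_takeD)
      show "q' \<noteq> r" "q \<noteq> q'" using q' \<open>q \<notin> set (take x qs)\<close> by auto
    qed (use q in auto)
    then have "b q" using succ[OF x(1)] ne unfolding x(2) by auto
    with \<open>\<not> b r\<close> show ?thesis by simp
  qed
qed

section \<open>Executions in which every process performs at most one call\<close>

text \<open>The status \<open>Idle\<close> of the model does not tell a process before its call from
  one after it. Phases do, and they also remember the response, so that results can be read off a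
  state.\<close>

datatype 's phase = Waiting | Running 's | is_finished: Finished (result: bool) 's

fun status_of :: "'s \<Rightarrow> 's phase \<Rightarrow> 's status" where
  "status_of s0 Waiting = Idle s0"
| "status_of s0 (Running s) = Busy s"
| "status_of s0 (Finished b s) = Idle s"

datatype ('p, 's, 'l, 'w) sys = Sys (memory: "'l \<Rightarrow> 'w") (phases: "'p \<Rightarrow> 's phase")

locale one_shot =
  fixes k :: nat
    and A :: "('p, 's, 'l, 'w, 'a, 'v) implementation"
    and P :: "'p set"
    and cc :: "'p \<Rightarrow> ('a, 'v) kcas_call"
  assumes finite_P: "finite P"
    and valid: "q \<in> P \<Longrightarrow> valid_call k (cc q)"
    and lock_free: "lock_free k A"
begin

text \<open>A finished process stays put; the event assigned to its idle moves is a dummy that is never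
  recorded by \<open>path\<close> below.\<close>

definition effect ::
    "'p \<Rightarrow> 's phase \<Rightarrow> ('l \<Rightarrow> 'w) \<Rightarrow> ('l \<Rightarrow> 'w) \<times> 's phase \<times> ('p, 'l, 'w, 'a, 'v) event" where
  "effect q x M = (case x of
     Waiting \<Rightarrow> (M, Running (begin_call A q (init_local A q) (cc q)), Invoke q (cc q))
   | Running s \<Rightarrow> (case program A q s of
       Read y f \<Rightarrow> (M, Running (f (M y)), ReadEv q y (M y))
     | Write y w s' \<Rightarrow> (M(y := w), Running s', WriteEv q y w)
     | CAS y e w f \<Rightarrow>
         (if M y = e then M(y := w) else M, Running (f (M y = e)), CASEv q y e w (M y = e))
     | Return b s' \<Rightarrow> (M, Finished b s', Respond q b))
   | Finished b s \<Rightarrow> (M, Finished b s, Respond q b))"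

text \<open>A total function, so that a solo run of \<open>q\<close> is an iterate of
  \<open>move q\<close>. Determinism of the processes makes such a function possible.\<close>

definition move :: "'p \<Rightarrow> ('p, 's, 'l, 'w) sys \<Rightarrow> ('p, 's, 'l, 'w) sys" where
  "move q S = Sys (fst (effect q (phases S q) (memory S)))
    ((phases S)(q := fst (snd (effect q (phases S q) (memory S)))))"

definition event :: "'p \<Rightarrow> ('p, 's, 'l, 'w) sys \<Rightarrow> ('p, 'l, 'w, 'a, 'v) event" where
  "event q S = snd (snd (effect q (phases S q) (memory S)))"

definition enabled :: "'p \<Rightarrow> ('p, 's, 'l, 'w) sys \<Rightarrow> bool" where
  "enabled q S \<longleftrightarrow> q \<in> P \<and> \<not> is_finished (phases S q)"

definition config_of :: "('p, 's, 'l, 'w) sys \<Rightarrow> ('p, 's, 'l, 'w) config" where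
  "config_of S = (memory S, \<lambda>q. status_of (init_local A q) (phases S q))"

definition start :: "('p, 's, 'l, 'w) sys" where
  "start = Sys (init_mem A) (\<lambda>_. Waiting)"

text \<open>Grows at the end, unlike \<open>run\<close>, because the invariants below relate the
  events so far to the last state. Only enabled processes move, so idle moves leave no
  event.\<close>

inductive path ::
    "('p, 's, 'l, 'w) sys \<Rightarrow> ('p, 'l, 'w, 'a, 'v) event list \<Rightarrow> ('p, 's, 'l, 'w) sys \<Rightarrow> bool"
  for S where
  path_Nil: "path S [] S"
| path_snoc: "path S E T \<Longrightarrow> enabled q T \<Longrightarrow> path S (E @ [event q T]) (move q T)"

definition reach :: "('p, 's, 'l, 'w) sys \<Rightarrow> ('p, 's, 'l, 'w) sys \<Rightarrow> bool" where
  "reach S T \<longleftrightarrow> (\<exists>E. path S E T)"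

lemma config_of_start: "config_of start = initial A"
  by (simp add: config_of_def start_def initial_def)

lemma proc_event [simp]: "proc (event q S) = q"
  by (auto simp: event_def effect_def split: phase.split action.split)

lemma snd_move_other: "q' \<noteq> q \<Longrightarrow> phases (move q S) q' = phases S q'"
  by (simp add: move_def)

lemma move_finished: "is_finished (phases S q) \<Longrightarrow> move q S = S"
  by (cases "phases S q") (auto simp: move_def effect_def fun_upd_idem)

lemma move_not_Waiting: "phases (move q S) q \<noteq> Waiting"
  by (auto simp: move_def effect_def split: phase.split action.split)

lemma move_finished_iff:
  assumes "enabled q S"
  shows "is_finished (phases (move q S) q) \<longleftrightarrow> is_Respond (event q S)"
  using assms
  by (auto simp: move_def event_def enabled_def effect_def split: phase.split action.split)

lemma finished_reach_result:
  assumes "path S E T" "is_finished (phases S q)"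
  shows "phases T q = phases S q"
  using assms
proof (induction rule: path.induct)
  case (path_snoc E T q')
  then have "q' \<noteq> q" by (auto simp: enabled_def)
  with path_snoc show ?case by (simp add: snd_move_other)
qed simp

lemma step_config_of:
  assumes "enabled q S"
  shows "step k A (config_of S) (event q S) (config_of (move q S))"
proof -
  obtain M ph where S: "S = Sys M ph" by (rule sys.exhaust)
  let ?L = "\<lambda>q. status_of (init_local A q) (ph q)"
  \<comment> \<open>Passing from phases to statuses commutes with an update. This brings
    \<open>move\<close> into the form of the rules for \<open>step\<close>.\<close>
  have upd: "(\<lambda>q'. status_of (init_local A q') ((ph(q := x)) q')) =
      ?L(q := status_of (init_local A q) x)" for x
    by auto
  show ?thesis
  proof (cases "ph q")
    case Waiting
    then have "step k A (M, ?L) (Invoke q (cc q))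
        (M, ?L(q := Busy (begin_call A q (init_local A q) (cc q))))"
      by (intro step_invoke) (use assms valid in \<open>auto simp: enabled_def\<close>)
    then show ?thesis
      using Waiting by (simp add: S config_of_def move_def event_def effect_def upd del: fun_upd_apply)
  next
    case (Running s)
    then have L: "?L q = Busy s" by simp
    show ?thesis
    proof (cases "program A q s")
      case (Read y f)
      show ?thesis
        using Running Read step_read[where L = ?L, OF L Read, of k M]
        by (simp add: S config_of_def move_def event_def effect_def upd del: fun_upd_apply)
    next
      case (Write y w s')
      show ?thesis
        using Running Write step_write[where L = ?L, OF L Write, of k M]
        by (simp add: S config_of_def move_def event_def effect_def upd del: fun_upd_apply)
    next
      case (CAS y e w f)
      show ?thesis
        using Running CAS step_cas[where L = ?L, OF L CAS, of k M]
        by (simp add: S config_of_def move_def event_def effect_def upd del: fun_upd_apply)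
    next
      case (Return b s')
      show ?thesis
        using Running Return step_return[where L = ?L, OF L Return, of k M]
        by (simp add: S config_of_def move_def event_def effect_def upd del: fun_upd_apply)
    qed
  next
    case Finished
    then show ?thesis using assms by (simp add: enabled_def S)
  qed
qed

lemma run_snoc: "run k A C E C' \<Longrightarrow> step k A C' e C'' \<Longrightarrow> run k A C (E @ [e]) C''"
  by (induction rule: run.induct) (auto intro: run.intros)

lemma path_run: "path S E T \<Longrightarrow> run k A (config_of S) E (config_of T)"
  by (induction rule: path.induct) (auto intro: run_Nil run_snoc step_config_of)

lemma path_execution: "path start E T \<Longrightarrow> execution k A E"
  using path_run config_of_start by (metis execution_def)

lemma path_append:
  assumes "path T F U" "path S E T"
  shows "path S (E @ F) U"
  using assms
  by (induction rule: path.induct) (auto intro: path_snoc simp flip: append_assoc)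

lemma reach_refl: "reach S S"
  unfolding reach_def using path_Nil by blast

lemma reach_trans: "reach S T \<Longrightarrow> reach T U \<Longrightarrow> reach S U"
  using path_append by (meson reach_def)

lemma reach_move: "q \<in> P \<Longrightarrow> reach S (move q S)"
  using path_snoc[OF path_Nil, of q S] path_Nil[of S] move_finished[of S q]
  by (cases "is_finished (phases S q)") (auto simp: reach_def enabled_def)

lemma reach_funpow: "q \<in> P \<Longrightarrow> reach S ((move q ^^ n) S)"
  by (induction n) (auto intro: reach_refl reach_trans reach_move)

text \<open>Paths are built from their last step, whereas the valency argument looks at the first
  step taken from a critical state. This lemma exposes that step.\<close>

lemma path_first:
  assumes "path S E T"
  shows "T = S \<or> (\<exists>q\<in>P. enabled q S \<and> reach (move q S) T)"
  using assms
proof (induction rule: path.induct)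
  case (path_snoc E T q)
  then show ?case
    using reach_refl reach_trans reach_move by (metis enabled_def)
qed simp

subsection \<open>Termination\<close>

definition infinite_from :: "('p, 's, 'l, 'w) sys \<Rightarrow> bool" where
  "infinite_from S \<longleftrightarrow>
    (\<exists>f qs. f 0 = S \<and> (\<forall>n. enabled (qs n) (f n) \<and> f (Suc n) = move (qs n) (f n)))"

text \<open>Lock-freedom speaks only of infinite executions from the initial configuration, so an
  infinite schedule from a later state has to be prolonged backwards.\<close>

lemma infinite_from_path:
  assumes "path S E T" "infinite_from T"
  shows "infinite_from S"
  using assms
proof (induction rule: path.induct)
  case (path_snoc E T q)
  from path_snoc.prems obtain f qs where
    f: "f 0 = move q T" "\<And>n. enabled (qs n) (f n) \<and> f (Suc n) = move (qs n) (f n)"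
    by (auto simp: infinite_from_def)
  have "infinite_from T"
    unfolding infinite_from_def
  proof (intro exI conjI allI)
    \<comment> \<open>\<open>case_nat T f\<close> is the sequence \<open>f\<close> with
      \<open>T\<close> put in front. The sequence of moving processes is shifted in the same
      way.\<close>
    show "case_nat T f 0 = T" by simp
    fix n
    show "enabled (case_nat q qs n) (case_nat T f n)"
      using f path_snoc.hyps(2) by (cases n) auto
    show "case_nat T f (Suc n) = move (case_nat q qs n) (case_nat T f n)"
      using f by (cases n) auto
  qed
  then show ?case by (rule path_snoc.IH)
qed simp

text \<open>Each of the finitely many processes responds at most once, so an infinite schedule has a
  last response. Some process moves infinitely often without ever finishing, and lock-freedom then
  demands a response after that last one.\<close>

lemma not_infinite_from_start: "\<not> infinite_from start"
proof
  assume "infinite_from start"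
  then obtain f qs where f0: "f 0 = start"
    and en: "\<And>n. enabled (qs n) (f n)" and f: "\<And>n. f (Suc n) = move (qs n) (f n)"
    by (auto simp: infinite_from_def)
  define ev where "ev n = event (qs n) (f n)" for n
  have inf: "infinite_execution k A (\<lambda>n. config_of (f n)) ev"
    using step_config_of[OF en] f0 config_of_start f
    by (simp add: infinite_execution_def ev_def)
  have path: "\<exists>E. path (f m) E (f (m + d))" for m d
  proof (induction d)
    case 0
    then show ?case using path_Nil by auto
  next
    case (Suc d)
    then show ?case using path_snoc[OF _ en] f by fastforce
  qed
  \<comment> \<open>Being finished is permanent and disables the process, so whoever moves at time
    \<open>n\<close> is unfinished at all times up to \<open>n\<close>.\<close>
  have no_finish: "\<not> is_finished (phases (f m) (qs n))" if "m \<le> n" for m n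
    using path[of m "n - m"] that finished_reach_result en[of n]
    by (metis enabled_def le_add_diff_inverse)
  have "inj_on qs {m. is_Respond (ev m)}"
  proof (rule linorder_inj_onI)
    fix m n assume "m < n" "m \<in> {m. is_Respond (ev m)}"
    then show "qs m \<noteq> qs n"
      using move_finished_iff[OF en, of m] no_finish[of "Suc m" n] f ev_def by auto
  qed auto
  moreover have "qs ` {m. is_Respond (ev m)} \<subseteq> P"
    using en by (auto simp: enabled_def)
  ultimately have "finite {m. is_Respond (ev m)}"
    using finite_P inj_on_finite by blast
  then obtain N where N: "\<And>m. is_Respond (ev m) \<Longrightarrow> m < N"
    using finite_nat_set_iff_bounded by auto
  have "finite (range qs)"
    using en finite_P by (auto simp: enabled_def intro: finite_subset)
  then obtain n where n: "infinite {m. qs m = qs n}"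
    using pigeonhole_infinite[of "UNIV :: nat set" qs] by auto
  have not_Waiting: "phases (f (Suc n + d)) (qs n) \<noteq> Waiting" for d
  proof (induction d)
    case 0
    then show ?case using f move_not_Waiting by simp
  next
    case (Suc d)
    then show ?case using f move_not_Waiting snd_move_other by (metis add_Suc_right)
  qed
  \<comment> \<open>At this time no response is left to come, because of \<open>N\<close>, and the
    process \<open>qs n\<close> has been invoked, because it moved at time \<open>n\<close>.\<close>
  define m where "m = Suc n + N"
  obtain n' where "m \<le> n'" "qs n' = qs n"
    using n by (auto simp: finite_nat_set_iff_bounded not_less)
  then have "\<not> is_finished (phases (f m) (qs n))" using no_finish by metis
  moreover have "phases (f m) (qs n) \<noteq> Waiting" using not_Waiting m_def by simp
  ultimately have "ongoing (config_of (f m)) (qs n)"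
    by (cases "phases (f m) (qs n)") (auto simp: ongoing_def config_of_def)
  moreover have "infinite {m. proc (ev m) = qs n}" using n by (simp add: ev_def)
  ultimately obtain m' where "m' \<ge> m" "is_Respond (ev m')"
    using lock_free inf unfolding lock_free_def by blast
  then show False using N m_def by fastforce
qed

lemma wf_moves: "wf {(move q S, S) |q S. reach start S \<and> enabled q S}"
  unfolding wf_iff_no_infinite_down_chain
proof
  assume "\<exists>f. \<forall>i. (f (Suc i), f i) \<in> {(move q S, S) |q S. reach start S \<and> enabled q S}"
  then obtain f where
    "\<forall>i. \<exists>q. f (Suc i) = move q (f i) \<and> reach start (f i) \<and> enabled q (f i)"
    by auto
  then obtain qs where
    "\<And>i. f (Suc i) = move (qs i) (f i) \<and> reach start (f i) \<and> enabled (qs i) (f i)"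
    by metis
  then have "infinite_from (f 0)" "reach start (f 0)" by (auto simp: infinite_from_def)
  then show False
    using infinite_from_path not_infinite_from_start by (auto simp: reach_def)
qed

text \<open>Termination of all schedules as an induction principle: a property may be assumed for
  all successors of a state. It replaces any bound on the number of steps.\<close>

lemma move_induct [consumes 1]:
  assumes "reach start S"
    and "\<And>S. reach start S \<Longrightarrow> (\<And>q. enabled q S \<Longrightarrow> Q (move q S)) \<Longrightarrow> Q S"
  shows "Q S"
  using wf_moves assms(1)
proof (induction S rule: wf_induct_rule)
  case (less S)
  have "Q (move q S)" if "enabled q S" for q
  proof (rule less.IH)
    show "(move q S, S) \<in> {(move q S, S) |q S. reach start S \<and> enabled q S}"
      using that less.prems by blast
    show "reach start (move q S)"
      using that less.prems reach_trans reach_move by (auto simp: enabled_def)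
  qed
  then show ?case using assms(2) less.prems by blast
qed

section \<open>Complete states and solo runs\<close>

definition complete :: "('p, 's, 'l, 'w) sys \<Rightarrow> bool" where
  "complete S \<longleftrightarrow> (\<forall>q\<in>P. is_finished (phases S q))"

lemma ex_complete: "reach start S \<Longrightarrow> \<exists>T. reach S T \<and> complete T"
proof (induction S rule: move_induct)
  case (1 S)
  then show ?case
    using reach_refl reach_move reach_trans by (metis complete_def enabled_def)
qed

text \<open>As long as \<open>q\<close> is unfinished, each of its moves descends in the
  well-founded order of states, whatever the other processes have left pending.\<close>

lemma ex_solo: "reach start S \<Longrightarrow> q \<in> P \<Longrightarrow> \<exists>n. is_finished (phases ((move q ^^ n) S) q)"
proof (induction S rule: move_induct)
  case (1 S)
  show ?case
  proof (cases "is_finished (phases S q)")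
    case True
    then show ?thesis by (metis funpow_0)
  next
    case False
    then obtain n where "is_finished (phases ((move q ^^ n) (move q S)) q)"
      using 1 by (auto simp: enabled_def)
    then show ?thesis by (metis comp_apply funpow_Suc_right)
  qed
qed

lemma funpow_move_other: "q' \<noteq> q \<Longrightarrow> phases ((move q ^^ n) S) q' = phases S q'"
  by (induction n) (auto simp: snd_move_other)

text \<open>A move of \<open>q\<close> depends only on the memory and on the phase of
  \<open>q\<close>. States that agree on both therefore look the same to \<open>q\<close> throughout
  a solo run.\<close>

lemma funpow_move_local:
  assumes "memory S = memory T" "phases S q = phases T q"
  shows "memory ((move q ^^ n) S) = memory ((move q ^^ n) T) \<and>
    phases ((move q ^^ n) S) q = phases ((move q ^^ n) T) q"
  using assms by (induction n) (auto simp: move_def)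

subsection \<open>The position of a call in the event list\<close>

definition invoked_at :: "('p, 'l, 'w, 'a, 'v) event list \<Rightarrow> 'p \<Rightarrow> nat \<Rightarrow> bool" where
  "invoked_at E q n \<longleftrightarrow> n < length E \<and> E ! n = Invoke q (cc q) \<and>
    (\<forall>m<length E. proc (E ! m) = q \<and> m \<noteq> n \<longrightarrow> n < m \<and> \<not> is_Invoke (E ! m))"

definition ended_at :: "('p, 'l, 'w, 'a, 'v) event list \<Rightarrow> 'p \<Rightarrow> bool \<Rightarrow> nat \<Rightarrow> bool" where
  "ended_at E q b j \<longleftrightarrow> j < length E \<and> E ! j = Respond q b \<and>
    (\<forall>m<length E. proc (E ! m) = q \<and> m \<noteq> j \<longrightarrow> m < j \<and> \<not> is_Respond (E ! m))"

text \<open>The invariant of paths that ties the phase of a process to its events. It allows the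
  positions of invocation and response to be recovered from the last state.\<close>

definition history :: "('p, 'l, 'w, 'a, 'v) event list \<Rightarrow> 'p \<Rightarrow> 's phase \<Rightarrow> bool" where
  "history E q x = (case x of
     Waiting \<Rightarrow> \<forall>m<length E. proc (E ! m) \<noteq> q
   | Running s \<Rightarrow> (\<exists>n. invoked_at E q n) \<and>
       (\<forall>m<length E. proc (E ! m) = q \<longrightarrow> \<not> is_Respond (E ! m))
   | Finished b s \<Rightarrow> (\<exists>n j. invoked_at E q n \<and> ended_at E q b j))"

lemma invoked_at_snoc:
  assumes "invoked_at E q n" "\<not> (is_Invoke e \<and> proc e = q)"
  shows "invoked_at (E @ [e]) q n"
  using assms by (auto simp: invoked_at_def nth_append less_Suc_eq)

lemma history_snoc_other:
  assumes "history E q x" "proc e \<noteq> q"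
  shows "history (E @ [e]) q x"
proof (cases x)
  case Waiting
  then show ?thesis using assms by (auto simp: history_def nth_append less_Suc_eq)
next
  case (Running s)
  then show ?thesis using assms invoked_at_snoc[of E q _ e]
    by (auto simp: history_def nth_append less_Suc_eq)
next
  case (Finished b s)
  then obtain n j where nj: "invoked_at E q n" "ended_at E q b j"
    using assms(1) by (auto simp: history_def)
  have "ended_at (E @ [e]) q b j"
    using nj(2) assms(2) by (auto simp: ended_at_def nth_append less_Suc_eq)
  with Finished show ?thesis
    using nj(1) assms(2) invoked_at_snoc[of E q n e] by (auto simp: history_def)
qed

lemma history_snoc_same:
  assumes "history E q (phases S q)" "enabled q S"
  shows "history (E @ [event q S]) q (phases (move q S) q)"
proof (cases "phases S q")
  case Waiting
  have e: "event q S = Invoke q (cc q)" using Waiting by (simp add: event_def effect_def)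
  have "\<forall>m<length E. proc (E ! m) \<noteq> q" using assms(1) Waiting by (simp add: history_def)
  then have "invoked_at (E @ [event q S]) q (length E)"
    "\<forall>m<length (E @ [event q S]). proc ((E @ [event q S]) ! m) = q \<longrightarrow>
      \<not> is_Respond ((E @ [event q S]) ! m)"
    by (auto simp: invoked_at_def e nth_append less_Suc_eq)
  then show ?thesis
    using Waiting by (auto simp: history_def move_def effect_def)
next
  case (Running s)
  then obtain n where n: "invoked_at E q n"
    and no_resp: "\<And>m. m < length E \<Longrightarrow> proc (E ! m) = q \<Longrightarrow> \<not> is_Respond (E ! m)"
    using assms(1) by (auto simp: history_def)
  have "\<not> is_Invoke (event q S)"
    using Running by (auto simp: event_def effect_def split: action.split)
  then have n': "invoked_at (E @ [event q S]) q n" using n invoked_at_snoc by auto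
  show ?thesis
  proof (cases "is_Respond (event q S)")
    case True
    then obtain b s' where b: "event q S = Respond q b" "phases (move q S) q = Finished b s'"
      using Running by (auto simp: event_def move_def effect_def split: action.splits)
    have "ended_at (E @ [event q S]) q b (length E)"
      using no_resp by (auto simp: ended_at_def b(1) nth_append less_Suc_eq)
    then show ?thesis using n' b(2) by (auto simp: history_def)
  next
    case False
    then obtain s' where "phases (move q S) q = Running s'"
      using Running by (auto simp: event_def move_def effect_def split: action.splits)
    then show ?thesis
      using False n' no_resp by (auto simp: history_def nth_append less_Suc_eq)
  qed
next
  case Finished
  then show ?thesis using assms(2) by (simp add: enabled_def)
qed

lemma path_history: "path start E S \<Longrightarrow> history E q (phases S q)"
proof (induction rule: path.induct)
  case path_Nil
  then show ?case by (simp add: history_def start_def)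
next
  case (path_snoc E T q')
  then show ?case
    using history_snoc_same history_snoc_other snd_move_other proc_event
    by (cases "q' = q") metis+
qed

lemma path_proc: "path start E S \<Longrightarrow> e \<in> set E \<Longrightarrow> proc e \<in> P"
  by (induction rule: path.induct) (auto simp: enabled_def)

text \<open>Every process with an event has been invoked and, as no call is pending, has finished.
  Its single invocation and single response then enclose all its other events.\<close>

lemma quiescent_calls:
  assumes path: "path start E S"
    and quiescent: "\<And>q. q \<in> P \<Longrightarrow> phases S q = Waiting \<or> is_finished (phases S q)"
  defines "D \<equiv> {q \<in> P. is_finished (phases S q)}"
  shows "\<exists>n. calls E = n ` D \<and> (\<forall>q\<in>D. E ! n q = Invoke q (cc q) \<and>
    (\<exists>j. responds_at E (n q) j (result (phases S q))) \<and>
    (\<forall>m<length E. proc (E ! m) = q \<and> m \<noteq> n q \<longrightarrow> in_call E (n q) m))"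
proof -
  have "\<exists>n j. invoked_at E q n \<and> ended_at E q (result (phases S q)) j" if "q \<in> D" for q
    using path_history[OF path, of q] that by (auto simp: D_def history_def split: phase.splits)
  then obtain n j where n: "\<And>q. q \<in> D \<Longrightarrow> invoked_at E q (n q)"
    and j: "\<And>q. q \<in> D \<Longrightarrow> ended_at E q (result (phases S q)) (j q)"
    by metis
  have "m \<in> n ` D" if m: "m \<in> calls E" for m
  proof -
    define q where "q = proc (E ! m)"
    have "q \<in> P" using m path_proc[OF path] by (auto simp: calls_def q_def)
    moreover have "phases S q \<noteq> Waiting"
      using path_history[OF path, of q] m by (auto simp: calls_def q_def history_def)
    ultimately have "q \<in> D" using quiescent by (auto simp: D_def)
    moreover have "m = n q" using n[OF \<open>q \<in> D\<close>] m by (auto simp: invoked_at_def calls_def q_def)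
    ultimately show ?thesis by blast
  qed
  moreover have "n ` D \<subseteq> calls E" using n by (auto simp: calls_def invoked_at_def)
  ultimately have "calls E = n ` D" by blast
  \<comment> \<open>No response of \<open>q\<close> lies strictly between \<open>n q\<close> and
    \<open>m\<close>, because the only one is at \<open>j q\<close>, which no other event of
    \<open>q\<close> follows.\<close>
  moreover have in_call: "in_call E (n q) m"
    if "q \<in> D" "m < length E" "proc (E ! m) = q" "m \<noteq> n q" for q m
    using n[OF that(1)] j[OF that(1)] that(2-)
    unfolding invoked_at_def ended_at_def in_call_def
    by (metis event.sel(1) less_asym less_trans)
  moreover have "responds_at E (n q) (j q) (result (phases S q))" if "q \<in> D" for q
  proof -
    have "j q < length E" "E ! j q = Respond q (result (phases S q))" "E ! n q = Invoke q (cc q)"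
      using n[OF that] j[OF that] by (auto simp: invoked_at_def ended_at_def)
    moreover from this have "j q \<noteq> n q" by auto
    ultimately show ?thesis using in_call[OF that, of "j q"] by (simp add: responds_at_def)
  qed
  ultimately show ?thesis
    using n unfolding invoked_at_def by blast
qed

text \<open>Without pending calls a linearization has to contain exactly the finished ones. Naming
  each call by its process turns it into an order of the finished processes that explains their
  results sequentially.\<close>

lemma quiescent_linearization:
  assumes path: "path start E S"
    and quiescent: "\<And>q. q \<in> P \<Longrightarrow> phases S q = Waiting \<or> is_finished (phases S q)"
    and lin: "linearizable k s A"
  shows "\<exists>qs. distinct qs \<and> set qs = {q \<in> P. is_finished (phases S q)} \<and>
    (\<forall>x<length qs. snd (kcas (cc (qs ! x)) (seq_state cc s (take x qs))) =
      result (phases S (qs ! x)))"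
proof -
  define D where "D = {q \<in> P. is_finished (phases S q)}"
  obtain n where n: "calls E = n ` D"
    and calls: "\<forall>q\<in>D. E ! n q = Invoke q (cc q) \<and>
      (\<exists>j. responds_at E (n q) j (result (phases S q)))"
    using quiescent_calls[OF path quiescent, folded D_def] by auto
  from calls have nq: "\<And>q. q \<in> D \<Longrightarrow> E ! n q = Invoke q (cc q)"
    and resp: "\<And>q. q \<in> D \<Longrightarrow> \<exists>j. responds_at E (n q) j (result (phases S q))"
    by auto
  obtain L where L: "linearization s E L"
    using lin path_execution[OF path] unfolding linearizable_def by blast
  have "calls E \<subseteq> {m \<in> calls E. completed E m}"
    using resp unfolding n completed_def by blast
  then have set_L: "set L = n ` D" and "distinct L"
    using L n unfolding linearization_def by blast+
  \<comment> \<open>Taking the process of an event inverts \<open>n\<close> on the positions in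
    \<open>L\<close>, so \<open>qs\<close> inherits distinctness from \<open>L\<close>.\<close>
  define qs where "qs = map (\<lambda>m. proc (E ! m)) L"
  have nqs: "n (proc (E ! m)) = m" "proc (E ! m) \<in> D" if "m \<in> set L" for m
    using that nq set_L by auto
  have "distinct qs"
    unfolding qs_def distinct_map using \<open>distinct L\<close> nqs by (auto intro: inj_on_inverseI)
  moreover have "set qs = D"
    unfolding qs_def using set_L nq by (force simp: image_image)
  moreover have "snd (kcas (cc (qs ! x)) (seq_state cc s (take x qs))) = result (phases S (qs ! x))"
    if x: "x < length qs" for x
  proof -
    have "L ! x \<in> set L" using x by (simp add: qs_def)
    have x': "x < length L" "qs ! x \<in> D" "n (qs ! x) = L ! x"
      using x nqs[OF \<open>L ! x \<in> set L\<close>] by (auto simp: qs_def)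
    obtain j where j: "responds_at E (L ! x) j (result (phases S (qs ! x)))"
      using resp[OF x'(2)] x'(3) by auto
    have "call_of (E ! m) = cc (proc (E ! m))" if "m \<in> set L" for m
      using nq[OF nqs(2)[OF that]] unfolding nqs(1)[OF that] by (metis event.sel)
    then have "fold (\<lambda>m t. fst (kcas (call_of (E ! m)) t)) (take x L) s =
        seq_state cc s (take x qs)"
      unfolding seq_state_def qs_def take_map fold_map
      by (intro fold_cong) (auto dest: in_set_takeD)
    moreover have "call_of (E ! (L ! x)) = cc (qs ! x)"
      using nq[OF x'(2)] unfolding x'(3) by simp
    moreover have "snd (kcas (call_of (E ! (L ! x)))
        (fold (\<lambda>m t. fst (kcas (call_of (E ! m)) t)) (take x L) s)) = result (phases S (qs ! x))"
      using L x'(1) j unfolding linearization_def by blast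
    ultimately show ?thesis by simp
  qed
  ultimately show ?thesis unfolding D_def by (intro exI[of _ qs]) simp
qed

end

section \<open>The critical state\<close>

text \<open>The centre is performed by \<open>r\<close>, the leaves by the other members of
  \<open>P\<close>. The condition \<open>P \<noteq> {r}\<close> provides a leaf, which makes a
  failure of the centre possible.\<close>

locale star = one_shot k A P cc
  for k :: nat and A :: "('p, 's, 'l, 'w, 'a, 'v) implementation" and P cc +
  fixes r :: 'p and s :: "'a \<Rightarrow> 'v"
  assumes r: "r \<in> P" and not_singleton: "P \<noteq> {r}"
    and linearizable: "linearizable k s A"
    and correct: "q \<in> P \<Longrightarrow> correct_old_values s (cc q)"
    and differ: "q \<in> P \<Longrightarrow> new_values_differ (cc q)"
    and meet: "q \<in> P \<Longrightarrow> q \<noteq> r \<Longrightarrow> targets (cc r) \<inter> targets (cc q) \<noteq> {}"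
    and disj: "q \<in> P \<Longrightarrow> q' \<in> P \<Longrightarrow> q \<noteq> r \<Longrightarrow> q' \<noteq> r \<Longrightarrow> q \<noteq> q' \<Longrightarrow>
      targets (cc q) \<inter> targets (cc q') = {}"
begin

section \<open>Results of complete states and valency\<close>

lemma result_complete:
  assumes "reach start S" "complete S" "q \<in> P"
  shows "result (phases S q) = (if q = r then result (phases S r) else \<not> result (phases S r))"
proof (cases "q = r")
  case False
  from assms obtain E where E: "path start E S" by (auto simp: reach_def)
  have quiescent: "phases S q = Waiting \<or> is_finished (phases S q)" if "q \<in> P" for q
    using that assms(2) by (simp add: complete_def)
  then obtain qs where qs: "distinct qs" "set qs = {q \<in> P. is_finished (phases S q)}"
    "\<And>x. x < length qs \<Longrightarrow> snd (kcas (cc (qs ! x)) (seq_state cc s (take x qs))) =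
      result (phases S (qs ! x))"
    using quiescent_linearization[OF E quiescent linearizable] by blast
  have "set qs = P" using qs(2) assms(2) by (auto simp: complete_def)
  have ok: "\<And>q. q \<in> P \<Longrightarrow> correct_old_values s (cc q) \<and> new_values_differ (cc q) \<and>
      distinct (map fst (cc q))"
    using correct differ valid by (simp add: valid_call_def)
  have "result (phases S q) = (\<not> result (phases S r))"
  proof (rule star_outcome[of P s cc r qs "\<lambda>q. result (phases S q)"])
    show "distinct qs" "set qs = P" "r \<in> P" "q \<in> P" "q \<noteq> r"
      using qs(1) \<open>set qs = P\<close> r assms(3) False by blast+
  qed (fact ok meet disj qs(3))+
  with False show ?thesis by simp
qed simp

text \<open>The valency of a state: \<open>UNIV\<close> means bivalent, a singleton univalent. The
  result of the centre suffices, since in a complete state it fixes all the others.\<close>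

definition outcomes :: "('p, 's, 'l, 'w) sys \<Rightarrow> bool set" where
  "outcomes S = {result (phases T r) |T. reach S T \<and> complete T}"

lemma outcomes_reach: "reach S T \<Longrightarrow> outcomes T \<subseteq> outcomes S"
  using reach_trans by (auto simp: outcomes_def)

lemma outcomes_nonempty: "reach start S \<Longrightarrow> outcomes S \<noteq> {}"
  using ex_complete by (fastforce simp: outcomes_def)

text \<open>A response is permanent, and in every completion it determines the result of the centre.
  Thus a bivalent state has no finished process.\<close>

lemma outcomes_finished:
  assumes "reach start S" "q \<in> P" "is_finished (phases S q)"
  shows "outcomes S = {if q = r then result (phases S q) else \<not> result (phases S q)}"
proof -
  have "result (phases T r) = (if q = r then result (phases S q) else \<not> result (phases S q))"
    if "reach S T" "complete T" for T
  proof -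
    have "phases T q = phases S q"
      using that(1) finished_reach_result assms(3) by (auto simp: reach_def)
    then show ?thesis
      using result_complete[OF reach_trans[OF assms(1) that(1)] that(2) assms(2)] by auto
  qed
  then have "outcomes S \<subseteq> {if q = r then result (phases S q) else \<not> result (phases S q)}"
    by (auto simp: outcomes_def)
  then show ?thesis using outcomes_nonempty[OF assms(1)] by blast
qed

text \<open>After a solo run of \<open>q\<close> its call is the only one to linearize, so it acts
  on the initial state and succeeds. This decides for the centre if \<open>q = r\<close> and against
  it otherwise.\<close>

lemma solo_outcome:
  assumes "q \<in> P"
  shows "(q = r) \<in> outcomes start"
proof -
  obtain n where n: "is_finished (phases ((move q ^^ n) start) q)"
    using ex_solo[OF reach_refl assms] by blast
  define S where "S = (move q ^^ n) start"
  have reach: "reach start S" unfolding S_def using assms by (rule reach_funpow)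
  then obtain E where E: "path start E S" by (auto simp: reach_def)
  have fin: "{q' \<in> P. is_finished (phases S q')} = {q}"
  proof (intro equalityI subsetI)
    fix q' assume "q' \<in> {q' \<in> P. is_finished (phases S q')}"
    then show "q' \<in> {q}"
      using funpow_move_other[of q' q n start] by (cases "q' = q") (auto simp: S_def start_def)
  qed (use n assms S_def in auto)
  have "phases S q' = Waiting \<or> is_finished (phases S q')" for q'
    using n funpow_move_other[of q' q n start] by (cases "q' = q") (auto simp: S_def start_def)
  then obtain qs where qs: "distinct qs" "set qs = {q}"
    "\<And>x. x < length qs \<Longrightarrow> snd (kcas (cc (qs ! x)) (seq_state cc s (take x qs))) =
      result (phases S (qs ! x))"
    using quiescent_linearization[OF E _ linearizable] unfolding fin by blast
  then have "length qs = 1" by (simp flip: distinct_card)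
  with qs(2) have "qs = [q]" by (cases qs) auto
  then have "result (phases S q) = snd (kcas (cc q) s)"
    using qs(3)[of 0] by (simp add: seq_state_def)
  then have "result (phases S q)"
    using kcas_success_iff[OF correct[OF assms], of s] by (simp add: changed_def)
  then have "outcomes S = {q = r}"
    using outcomes_finished[OF reach assms n[folded S_def]] by (cases "q = r") simp_all
  then show ?thesis using outcomes_reach[OF reach] by blast
qed

lemma outcomes_start: "outcomes start = UNIV"
proof -
  obtain q where "q \<in> P" "q \<noteq> r" using r not_singleton by blast
  then have "False \<in> outcomes start" using solo_outcome by fastforce
  moreover have "True \<in> outcomes start" using solo_outcome[OF r] by simp
  ultimately show ?thesis by (metis (full_types) UNIV_eq_I)
qed

text \<open>If a bivalent state is not critical, some move leads to another bivalent state. By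
  termination this cannot go on forever.\<close>

lemma ex_critical:
  "\<exists>S. reach start S \<and> outcomes S = UNIV \<and> (\<forall>q. enabled q S \<longrightarrow> outcomes (move q S) \<noteq> UNIV)"
proof -
  have "outcomes S = UNIV \<longrightarrow> ?thesis" if "reach start S" for S
    using that
  proof (induction S rule: move_induct)
    case (1 S)
    then show ?case by blast
  qed
  then show ?thesis using reach_refl outcomes_start by blast
qed

text \<open>The solo run of \<open>q\<close> returns the same result from both states, and that
  result alone decides the outcome. So both states admit a common outcome.\<close>

lemma indistinguishable_outcomes:
  assumes "reach start S" "reach start T" "q \<in> P" "memory S = memory T" "phases S q = phases T q"
  shows "outcomes S \<inter> outcomes T \<noteq> {}"
proof -
  obtain n where n: "is_finished (phases ((move q ^^ n) S) q)"
    using ex_solo[OF assms(1,3)] by blast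
  have same: "phases ((move q ^^ n) S) q = phases ((move q ^^ n) T) q"
    using funpow_move_local[OF assms(4,5)] by blast
  have reach: "reach start ((move q ^^ n) S)" "reach start ((move q ^^ n) T)"
    using assms(1-3) reach_funpow reach_trans by blast+
  have "outcomes ((move q ^^ n) S) = outcomes ((move q ^^ n) T)"
    unfolding outcomes_finished[OF reach(1) assms(3) n]
      outcomes_finished[OF reach(2) assms(3) n[unfolded same]] same ..
  moreover have "outcomes ((move q ^^ n) S) \<subseteq> outcomes S"
    "outcomes ((move q ^^ n) T) \<subseteq> outcomes T"
    using outcomes_reach reach_funpow[OF assms(3)] by blast+
  ultimately show ?thesis using outcomes_nonempty[OF reach(1)] by blast
qed

section \<open>Pairs of steps with opposite decisions\<close>

definition next_cas :: "'p \<Rightarrow> ('p, 's, 'l, 'w) sys \<Rightarrow> 'l \<Rightarrow> bool" where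
  "next_cas q S x \<longleftrightarrow> (\<exists>u e w f. phases S q = Running u \<and> program A q u = CAS x e w f)"

definition next_write :: "'p \<Rightarrow> ('p, 's, 'l, 'w) sys \<Rightarrow> 'l \<Rightarrow> bool" where
  "next_write q S x \<longleftrightarrow> (\<exists>u w u'. phases S q = Running u \<and> program A q u = Write x w u')"

lemma changing_move:
  assumes "memory (move q S) \<noteq> memory S"
  shows "\<exists>x. next_write q S x \<or> next_cas q S x"
  using assms
  by (auto simp: move_def effect_def next_write_def next_cas_def split: phase.splits action.splits)

text \<open>The effect of a write or CAS, including the success of the latter, depends only on its
  own location. Hence accesses to different locations commute.\<close>

lemma move_swap:
  assumes "q \<noteq> q'" "next_write q S x \<or> next_cas q S x" "next_write q' S y \<or> next_cas q' S y" "x \<noteq> y"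
  shows "move q' (move q S) = move q (move q' S)"
  using assms by (auto simp: move_def effect_def next_write_def next_cas_def fun_upd_twist)

text \<open>The write of \<open>q'\<close> erases whatever \<open>q\<close> did at \<open>x\<close>,
  and a write returns no information. So \<open>q'\<close> cannot tell whether \<open>q\<close>
  moved before it.\<close>

lemma move_overwrite:
  assumes "q \<noteq> q'" "next_write q S x \<or> next_cas q S x" "next_write q' S x"
  shows "memory (move q' (move q S)) = memory (move q' S)" "phases (move q' (move q S)) q' = phases (move q' S) q'"
  using assms by (auto simp: move_def effect_def next_write_def next_cas_def)

lemma move_invisible:
  assumes "q \<noteq> q'" "memory (move q S) = memory S"
  shows "memory (move q' (move q S)) = memory (move q' S)" "phases (move q' (move q S)) q' = phases (move q' S) q'"
proof -
  have "phases (move q S) q' = phases S q'" using snd_move_other assms(1) by metis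
  with assms(2) show "memory (move q' (move q S)) = memory (move q' S)"
    "phases (move q' (move q S)) q' = phases (move q' S) q'"
    by (simp_all add: move_def)
qed

lemma opposite_moves:
  assumes S: "reach start S" and q: "q \<in> P" "q' \<in> P"
    and opp: "outcomes (move q S) \<inter> outcomes (move q' S) = {}"
  shows "\<exists>x. next_cas q S x \<and> next_cas q' S x"
proof -
  have reach: "reach start (move q S)" "reach start (move q' S)"
    "reach start (move q' (move q S))" "reach start (move q (move q' S))"
    using S q reach_move reach_trans by blast+
  have sub: "outcomes (move q' (move q S)) \<subseteq> outcomes (move q S)"
    "outcomes (move q (move q' S)) \<subseteq> outcomes (move q' S)"
    using outcomes_reach reach_move q by blast+
  have ne: "q \<noteq> q'" using opp outcomes_nonempty[OF reach(1)] by auto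
  \<comment> \<open>Otherwise one of the two processes could not tell whether the other one moved
    first, although that decides the outcome. The two states would share an outcome, contrary to
    \<open>opp\<close>.\<close>
  have vis: "\<not> (memory (move q' (move q S)) = memory (move q' S) \<and>
      phases (move q' (move q S)) q' = phases (move q' S) q')"
    "\<not> (memory (move q (move q' S)) = memory (move q S) \<and>
      phases (move q (move q' S)) q = phases (move q S) q)"
    using indistinguishable_outcomes[OF reach(3,2) q(2)]
      indistinguishable_outcomes[OF reach(4,1) q(1)] sub opp by blast+
  \<comment> \<open>The step of \<open>q\<close> must change the memory, since otherwise
    \<open>q'\<close> would not notice it. This leaves only a write or a CAS, and the same holds for
    \<open>q'\<close>.\<close>
  obtain x where x: "next_write q S x \<or> next_cas q S x"
    using changing_move vis(1) move_invisible[OF ne] by blast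
  obtain y where y: "next_write q' S y \<or> next_cas q' S y"
    using changing_move vis(2) move_invisible[OF ne[symmetric]] by blast
  have "move q' (move q S) \<noteq> move q (move q' S)"
  proof
    assume "move q' (move q S) = move q (move q' S)"
    with sub(2) have "outcomes (move q' (move q S)) \<subseteq> outcomes (move q' S)" by simp
    with sub(1) show False using opp outcomes_nonempty[OF reach(3)] by blast
  qed
  then have "x = y" using move_swap[OF ne x y] by blast
  \<comment> \<open>If either process wrote to the common location, it would overwrite the trace of
    the other one. Only CAS remains for both.\<close>
  moreover have "\<not> next_write q' S x" "\<not> next_write q S x"
    using vis move_overwrite[OF ne x] move_overwrite[OF ne[symmetric] y] \<open>x = y\<close> by blast+
  ultimately show ?thesis using x y by blast
qed

text \<open>At a critical state some \<open>q0\<close> decides against the centre and some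
  \<open>q1\<close> for it, and both have a CAS on one location \<open>x\<close> pending. Any
  process decides opposite to \<open>q0\<close> or to \<open>q1\<close>, so its next step is a CAS
  on \<open>x\<close> as well.\<close>

lemma ex_common_cas: "\<exists>S x. reach start S \<and> (\<forall>q\<in>P. next_cas q S x)"
proof -
  obtain S where S: "reach start S" "outcomes S = UNIV"
    and crit: "\<forall>q. enabled q S \<longrightarrow> outcomes (move q S) \<noteq> UNIV"
    using ex_critical by (elim exE conjE) (rule that)
  have en: "enabled q S" if q: "q \<in> P" for q
  proof (rule ccontr)
    assume "\<not> enabled q S"
    then have "is_finished (phases S q)" using q by (simp add: enabled_def)
    then obtain b where b: "outcomes S = {b}" using outcomes_finished[OF S(1) q] by blast
    have "(\<not> b) \<in> outcomes S" using S(2) by simp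
    then show False unfolding b by simp
  qed
  \<comment> \<open>A completion with outcome \<open>b\<close> exists, and it is not
    \<open>S\<close> itself because no process has finished there. So it starts with some
    move.\<close>
  have first: "\<exists>q\<in>P. b \<in> outcomes (move q S)" for b
  proof -
    have "b \<in> outcomes S" using S(2) by simp
    then obtain T where T: "reach S T" "complete T" "b = result (phases T r)"
      unfolding outcomes_def by blast
    have "T \<noteq> S" using T(2) en[OF r] r unfolding complete_def enabled_def by blast
    with T(1) obtain q where "q \<in> P" "reach (move q S) T"
      using path_first unfolding reach_def by blast
    then show ?thesis using T(2,3) unfolding outcomes_def by blast
  qed
  have decided: "outcomes (move q S) = {b}" if q: "q \<in> P" and b: "b \<in> outcomes (move q S)" for q b
  proof -
    have "d = b" if d: "d \<in> outcomes (move q S)" for d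
    proof (rule ccontr)
      assume "d \<noteq> b"
      then have bd: "{b, d} = UNIV" by (cases b; cases d) (simp_all add: UNIV_bool insert_commute)
      have "{b, d} \<subseteq> outcomes (move q S)" using b d by simp
      then have "outcomes (move q S) = UNIV" unfolding bd by (rule top.extremum_uniqueI)
      then show False using crit en[OF q] by simp
    qed
    then show ?thesis using b by blast
  qed
  have decisive: "\<exists>q\<in>P. outcomes (move q S) = {b}" for b
  proof -
    obtain q where "q \<in> P" "b \<in> outcomes (move q S)" using first[of b] by (elim bexE)
    with decided show ?thesis by (intro bexI[of _ q])
  qed
  obtain q0 where q0: "q0 \<in> P" "outcomes (move q0 S) = {False}"
    using decisive[of False] by (elim bexE)
  obtain q1 where q1: "q1 \<in> P" "outcomes (move q1 S) = {True}"
    using decisive[of True] by (elim bexE)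
  obtain x where x: "next_cas q0 S x" "next_cas q1 S x"
    using opposite_moves[OF S(1) q0(1) q1(1)] q0(2) q1(2) by auto
  \<comment> \<open>A deterministic process has a single next action. Therefore the locations
    obtained from different comparisons coincide.\<close>
  have unique: "y = z" if "next_cas q S y" "next_cas q S z" for q y z
    using that by (auto simp: next_cas_def)
  have "next_cas q S x" if q: "q \<in> P" for q
  proof -
    have "reach start (move q S)" using S(1) reach_move[OF q] reach_trans by blast
    then obtain b where "b \<in> outcomes (move q S)" using outcomes_nonempty by (meson ex_in_conv)
    then have b: "outcomes (move q S) = {b}" by (rule decided[OF q])
    obtain q' where q': "q' \<in> P" "outcomes (move q' S) = {\<not> b}" "next_cas q' S x"
    proof (cases b)
      case True
      then show thesis using that[OF q0(1)] q0(2) x(1) by simp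
    next
      case False
      then show thesis using that[OF q1(1)] q1(2) x(2) by simp
    qed
    have "outcomes (move q S) \<inter> outcomes (move q' S) = {}" unfolding b q'(2) by simp
    then obtain y where "next_cas q S y" "next_cas q' S y"
      using opposite_moves[OF S(1) q q'(1)] by blast
    with unique[OF q'(3)] show ?thesis by simp
  qed
  then show ?thesis using S(1) by blast
qed

text \<open>Only moves of \<open>q\<close> itself alter its phase, and the first of them is the
  pending CAS on \<open>x\<close>, whatever the others have done to the memory meanwhile.\<close>

lemma next_cas_path:
  assumes "path S F T" "next_cas q S x"
  shows "phases T q = phases S q \<or> (\<exists>e w b. CASEv q x e w b \<in> set F)"
  using assms
proof (induction rule: path.induct)
  case (path_snoc F T q')
  show ?case
  proof (cases "q' = q \<and> phases T q = phases S q")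
    case True
    then have "\<exists>e w b. event q' T = CASEv q x e w b"
      using path_snoc.prems by (auto simp: event_def effect_def next_cas_def)
    then show ?thesis by fastforce
  next
    case False
    then show ?thesis using path_snoc snd_move_other[of q q' T] by auto
  qed
qed simp

lemma ex_common_cas_execution:
  "\<exists>E S x. path start E S \<and> complete S \<and> (\<forall>q\<in>P. \<exists>e w b. CASEv q x e w b \<in> set E)"
proof -
  obtain S x where S: "reach start S" "\<And>q. q \<in> P \<Longrightarrow> next_cas q S x"
    using ex_common_cas by blast
  obtain T where T: "reach S T" "complete T" using ex_complete[OF S(1)] by blast
  obtain E F where EF: "path start E S" "path S F T" using S T by (auto simp: reach_def)
  \<comment> \<open>Every process is running at the critical state and finished in the completion,
    so its pending CAS is performed on the way, successfully or not.\<close>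
  have "\<exists>e w b. CASEv q x e w b \<in> set F" if q: "q \<in> P" for q
  proof -
    have "phases T q \<noteq> phases S q"
      using T(2) q S(2)[OF q] by (auto simp: complete_def next_cas_def)
    then show ?thesis using next_cas_path[OF EF(2) S(2)[OF q]] by blast
  qed
  then show ?thesis using path_append[OF EF(2,1)] T(2) by fastforce
qed

end

section \<open>From calls named by processes to numbered calls\<close>

theorem lemma2:
  fixes k l :: nat
    and A :: "('p, 's, 'l, 'w, 'a, 'v) implementation"
    and init :: "'a \<Rightarrow> 'v"
    and c :: "nat \<Rightarrow> ('a, 'v) kcas_call"
    and p :: "nat \<Rightarrow> 'p"
  assumes "lock_free_kcas_implementation k init A"
    and "\<forall>i\<le>l. valid_call k (c i)"
    and "star_configuration l c"
    and "\<forall>i\<le>l. correct_old_values init (c i)"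
    and "\<forall>i\<le>l. new_values_differ (c i)"
    and "inj_on p {..l}"
  shows "\<exists>E n. execution k A E \<and> calls E = n ` {..l} \<and>
    (\<forall>i\<le>l. E ! n i = Invoke (p i) (c i) \<and> completed E (n i)) \<and>
    (\<forall>i\<in>{1..l}. call_range E (n 0) \<inter> call_range E (n i) \<noteq> {})"
proof -
  define P where "P = p ` {..l}"
  \<comment> \<open>Calls are renamed by the processes that perform them. Injectivity of
    \<open>p\<close> makes the inverse recover the index.\<close>
  define cc where "cc q = c (inv_into {..l} p q)" for q
  have cc: "cc (p i) = c i" if "i \<le> l" for i
    using that assms(6) by (simp add: cc_def)
  have p_eq: "p i = p j \<longleftrightarrow> i = j" if "i \<le> l" "j \<le> l" for i j
    using that assms(6) by (auto simp: inj_on_def)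
  interpret one_shot k A P cc
    using assms(1,2) by unfold_locales (auto simp: P_def cc lock_free_kcas_implementation_def)
  \<comment> \<open>For \<open>l = 0\<close> there is no leaf and hence no bivalent start. The
    condition on the ranges is then vacuous and any complete execution serves.\<close>
  have "\<exists>E S x. path start E S \<and> complete S \<and>
      (1 \<le> l \<longrightarrow> (\<forall>q\<in>P. \<exists>e w b. CASEv q x e w b \<in> set E))"
  proof (cases "1 \<le> l")
    case True
    then have "p 1 \<in> P" "p 1 \<noteq> p 0" using p_eq by (auto simp: P_def)
    have index: "\<exists>i\<in>{1..l}. q = p i" if "q \<in> P" "q \<noteq> p 0" for q
      using that by (force simp: P_def Suc_le_eq intro: gr0I)
    interpret star k A P cc "p 0" init
    proof
      show "p 0 \<in> P" by (simp add: P_def)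
      show "P \<noteq> {p 0}" using \<open>p 1 \<in> P\<close> \<open>p 1 \<noteq> p 0\<close> by auto
      show "linearizable k init A"
        using assms(1) by (simp add: lock_free_kcas_implementation_def)
      show "correct_old_values init (cc q)" "new_values_differ (cc q)" if "q \<in> P" for q
        using that assms(4,5) by (auto simp: P_def cc)
      show "targets (cc (p 0)) \<inter> targets (cc q) \<noteq> {}" if q: "q \<in> P" "q \<noteq> p 0" for q
        using index[OF q] assms(3) cc unfolding star_configuration_def by force
      show "targets (cc q) \<inter> targets (cc q') = {}"
        if q: "q \<in> P" "q' \<in> P" "q \<noteq> p 0" "q' \<noteq> p 0" "q \<noteq> q'" for q q'
      proof -
        obtain i j where "i \<in> {1..l}" "q = p i" "j \<in> {1..l}" "q' = p j"
          using index q by metis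
        moreover from this have "i \<noteq> j" using q(5) by blast
        ultimately show ?thesis using assms(3) cc by (simp add: star_configuration_def)
      qed
    qed
    show ?thesis using ex_common_cas_execution by blast
  next
    case False
    then show ?thesis using ex_complete[OF reach_refl] by (auto simp: reach_def)
  qed
  then obtain E S x where E: "path start E S" and S: "complete S"
    and x: "\<And>q. 1 \<le> l \<Longrightarrow> q \<in> P \<Longrightarrow> \<exists>e w b. CASEv q x e w b \<in> set E"
    by blast
  have D: "{q \<in> P. is_finished (phases S q)} = P" using S by (auto simp: complete_def)
  have quiescent: "phases S q = Waiting \<or> is_finished (phases S q)" if "q \<in> P" for q
    using S that by (simp add: complete_def)
  obtain n where calls_E: "calls E = n ` P"
    and n: "\<forall>q\<in>P. E ! n q = Invoke q (cc q) \<and>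
      (\<exists>j. responds_at E (n q) j (result (phases S q))) \<and>
      (\<forall>m<length E. proc (E ! m) = q \<and> m \<noteq> n q \<longrightarrow> in_call E (n q) m)"
    using quiescent_calls[OF E quiescent] unfolding D by blast
  have completed: "\<forall>q\<in>P. completed E (n q)"
    using n unfolding completed_def by blast
  \<comment> \<open>Each process performs only one call, so its CAS on \<open>x\<close> belongs to
    that call. The single location \<open>x\<close> thus lies in the ranges of the centre and of all
    leaves.\<close>
  have range: "x \<in> call_range E (n q)" if q: "1 \<le> l" "q \<in> P" for q
  proof -
    have inv: "E ! n q = Invoke q (cc q)" using n q(2) by blast
    obtain e w b where "CASEv q x e w b \<in> set E" using x[OF q] by blast
    then obtain m where m: "m < length E" "E ! m = CASEv q x e w b"
      unfolding in_set_conv_nth by blast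
    then have "m \<noteq> n q" using inv by auto
    then have "in_call E (n q) m" using n q(2) m by simp
    then show ?thesis using m(2) inv unfolding call_range_def by auto
  qed
  show ?thesis
  proof (intro exI conjI)
    show "execution k A E" using E by (rule path_execution)
    show "calls E = (n \<circ> p) ` {..l}" using calls_E by (simp add: P_def image_comp)
    show "\<forall>i\<le>l. E ! (n \<circ> p) i = Invoke (p i) (c i) \<and> completed E ((n \<circ> p) i)"
      using n completed cc by (auto simp: P_def)
    show "\<forall>i\<in>{1..l}. call_range E ((n \<circ> p) 0) \<inter> call_range E ((n \<circ> p) i) \<noteq> {}"
      using range by (fastforce simp: P_def)
  qed
qed

end
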